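(* Let $(A,\rightarrow,\rightsquigarrow,1)$ be a pseudo-BE algebra and $\varphi$ a pseudo-valuation on $A$. Then $\varphi$ is commutative if and only if for all $x,y,z\in A$: $(cpv_3)$ $\varphi(x\vee_1 y\rightarrow x)\le\varphi(z\rightarrow(y\rightarrow x))+\varphi(z)$ and $(cpv_4)$ $\varphi(x\vee_2 y\rightsquigarrow x)\le\varphi(z\rightsquigarrow(y\rightsquigarrow x))+\varphi(z)$.
   Context: A pseudo-BE algebra is an algebra $(A,\rightarrow,\rightsquigarrow,1)$ of type $(2,2,0)$ such that for all $x,y,z\in A$: $x\rightarrow x=x\rightsquigarrow x=1$; $x\rightarrow 1=x\rightsquigarrow 1=1$; $1\rightarrow x=1\rightsquigarrow x=x$; $x\rightarrow(y\rightsquigarrow z)=y\rightsquigarrow(x\rightarrow z)$; $x\rightarrow y=1$ iff $x\rightsquigarrow y=1$. Put $x\vee_1 y=(x\rightarrow y)\rightsquigarrow y$, $x\vee_2 y=(x\rightsquigarrow y)\rightarrow y$; $x\vee_1 y\rightarrow x$ means $(x\vee_1 y)\rightarrow x$. A pseudo-valuation on $A$ is a map $\varphi:A\to\mathbb{R}$ with $\varphi(1)=0$ and $\varphi(y)-\varphi(x)\le\min\{\varphi(x\rightarrow y),\varphi(x\rightsquigarrow y)\}$ for all $x,y$. It is commutative if for all $x,y$: $\varphi((x\vee_1 y)\rightarrow x)\le\varphi(y\rightarrow x)$ and $\varphi((x\vee_2 y)\rightsquigarrow x)\le\varphi(y\rightsquigarrow x)$. *)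

theory Defs
  imports Complex_Main
begin

(* The carrier A is the whole type 'a; the operations are explicit arguments. *)

locale pseudo_BE_algebra =
  fixes imp1 :: "'a \<Rightarrow> 'a \<Rightarrow> 'a" (infixr "\<rightarrow>" 60)
    and imp2 :: "'a \<Rightarrow> 'a \<Rightarrow> 'a" (infixr "\<leadsto>" 60)
    and one :: 'a ("\<one>")
  assumes imp1_self: "x \<rightarrow> x = \<one>"
    and imp2_self: "x \<leadsto> x = \<one>"
    and imp1_one: "x \<rightarrow> \<one> = \<one>"
    and imp2_one: "x \<leadsto> \<one> = \<one>"
    and one_imp1: "\<one> \<rightarrow> x = x"
    and one_imp2: "\<one> \<leadsto> x = x"
    and exchange: "x \<rightarrow> (y \<leadsto> z) = y \<leadsto> (x \<rightarrow> z)"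
    and imp1_eq_one_iff: "x \<rightarrow> y = \<one> \<longleftrightarrow> x \<leadsto> y = \<one>"

definition vee1 :: "('a \<Rightarrow> 'a \<Rightarrow> 'a) \<Rightarrow> ('a \<Rightarrow> 'a \<Rightarrow> 'a) \<Rightarrow> 'a \<Rightarrow> 'a \<Rightarrow> 'a" where
  "vee1 imp1 imp2 x y = imp2 (imp1 x y) y"

definition vee2 :: "('a \<Rightarrow> 'a \<Rightarrow> 'a) \<Rightarrow> ('a \<Rightarrow> 'a \<Rightarrow> 'a) \<Rightarrow> 'a \<Rightarrow> 'a \<Rightarrow> 'a" where
  "vee2 imp1 imp2 x y = imp1 (imp2 x y) y"

definition pseudo_valuation ::
  "('a \<Rightarrow> 'a \<Rightarrow> 'a) \<Rightarrow> ('a \<Rightarrow> 'a \<Rightarrow> 'a) \<Rightarrow> 'a \<Rightarrow> ('a \<Rightarrow> real) \<Rightarrow> bool" where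
  "pseudo_valuation imp1 imp2 one \<phi> \<longleftrightarrow>
     \<phi> one = 0 \<and> (\<forall>x y. \<phi> y - \<phi> x \<le> min (\<phi> (imp1 x y)) (\<phi> (imp2 x y)))"

definition commutative_pseudo_valuation ::
  "('a \<Rightarrow> 'a \<Rightarrow> 'a) \<Rightarrow> ('a \<Rightarrow> 'a \<Rightarrow> 'a) \<Rightarrow> 'a \<Rightarrow> ('a \<Rightarrow> real) \<Rightarrow> bool" where
  "commutative_pseudo_valuation imp1 imp2 one \<phi> \<longleftrightarrow>
     pseudo_valuation imp1 imp2 one \<phi> \<and>
     (\<forall>x y. \<phi> (imp1 (vee1 imp1 imp2 x y) x) \<le> \<phi> (imp1 y x) \<and>
            \<phi> (imp2 (vee2 imp1 imp2 x y) x) \<le> \<phi> (imp2 y x))"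

end

theory Submission
  imports Defs
begin

text \<open>Subtracting \<open>\<phi> x\<close> in the definition of a pseudo-valuation hides a
  modus ponens bound: \<phi>(v) \<le> \<phi>(u \<rightarrow> v) + \<phi>(u), and likewise for
  \<leadsto>. With v = y \<rightarrow> x and u = z it says that weakening the premise by z costs at
  most \<phi>(z), so the commutativity bound \<phi>(y \<rightarrow> x) passes to the right-hand side
  with z. Conversely, the unit is a free premise: it has valuation 0 and implies exactly what is
  already there, so z = 1 gives commutativity back.\<close>

theorem theorem6p12:
  fixes imp1 :: "'a \<Rightarrow> 'a \<Rightarrow> 'a" (infixr "\<rightarrow>" 60)
    and imp2 :: "'a \<Rightarrow> 'a \<Rightarrow> 'a" (infixr "\<leadsto>" 60)
    and one :: 'a
    and \<phi> :: "'a \<Rightarrow> real"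
  assumes "pseudo_BE_algebra (\<rightarrow>) (\<leadsto>) one"
    and "pseudo_valuation (\<rightarrow>) (\<leadsto>) one \<phi>"
  shows "commutative_pseudo_valuation (\<rightarrow>) (\<leadsto>) one \<phi> \<longleftrightarrow>
    (\<forall>x y z.
      \<phi> (vee1 (\<rightarrow>) (\<leadsto>) x y \<rightarrow> x) \<le> \<phi> (z \<rightarrow> (y \<rightarrow> x)) + \<phi> z \<and>
      \<phi> (vee2 (\<rightarrow>) (\<leadsto>) x y \<leadsto> x) \<le> \<phi> (z \<leadsto> (y \<leadsto> x)) + \<phi> z)"
proof -
  interpret pseudo_BE_algebra "(\<rightarrow>)" "(\<leadsto>)" one by fact
  \<comment> \<open>Being below the minimum means being below both values, which yields one modus
    ponens bound for each implication.\<close>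
  have one: "\<phi> one = 0"
    and mp1: "\<phi> y \<le> \<phi> (x \<rightarrow> y) + \<phi> x"
    and mp2: "\<phi> y \<le> \<phi> (x \<leadsto> y) + \<phi> x" for x y
    using assms(2) unfolding pseudo_valuation_def by (auto simp: algebra_simps)
  show ?thesis
  proof
    assume "commutative_pseudo_valuation (\<rightarrow>) (\<leadsto>) one \<phi>"
    then have "\<phi> (vee1 (\<rightarrow>) (\<leadsto>) x y \<rightarrow> x) \<le> \<phi> (y \<rightarrow> x)"
      and "\<phi> (vee2 (\<rightarrow>) (\<leadsto>) x y \<leadsto> x) \<le> \<phi> (y \<leadsto> x)" for x y
      unfolding commutative_pseudo_valuation_def by auto
    then show "\<forall>x y z.
      \<phi> (vee1 (\<rightarrow>) (\<leadsto>) x y \<rightarrow> x) \<le> \<phi> (z \<rightarrow> (y \<rightarrow> x)) + \<phi> z \<and>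
      \<phi> (vee2 (\<rightarrow>) (\<leadsto>) x y \<leadsto> x) \<le> \<phi> (z \<leadsto> (y \<leadsto> x)) + \<phi> z"
      \<comment> \<open>The major premises are z \<rightarrow> (y \<rightarrow> x) for
        \<open>mp1\<close> and z \<leadsto> (y \<leadsto> x) for \<open>mp2\<close>; each bound is
        chained after the commutativity inequality.\<close>
      using mp1 mp2 by (blast intro: order_trans)
  next
    assume cpv: "\<forall>x y z.
      \<phi> (vee1 (\<rightarrow>) (\<leadsto>) x y \<rightarrow> x) \<le> \<phi> (z \<rightarrow> (y \<rightarrow> x)) + \<phi> z \<and>
      \<phi> (vee2 (\<rightarrow>) (\<leadsto>) x y \<leadsto> x) \<le> \<phi> (z \<leadsto> (y \<leadsto> x)) + \<phi> z"
    have "\<phi> (vee1 (\<rightarrow>) (\<leadsto>) x y \<rightarrow> x) \<le> \<phi> (y \<rightarrow> x) \<and>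
        \<phi> (vee2 (\<rightarrow>) (\<leadsto>) x y \<leadsto> x) \<le> \<phi> (y \<leadsto> x)" for x y
      \<comment> \<open>At z = \<open>one\<close> the outer implication collapses by the unit laws
        and the summand \<phi>(z) vanishes.\<close>
      using cpv[rule_format, of x y one] by (simp add: one one_imp1 one_imp2)
    with assms(2) show "commutative_pseudo_valuation (\<rightarrow>) (\<leadsto>) one \<phi>"
      unfolding commutative_pseudo_valuation_def by blast
  qed
qed

end
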